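(* Let $r$ and $n$ be positive integers and let $G$ be a simple $K_{r+1}$-free graph on $n$ vertices. Then \[ |E(G)| \le \left\lfloor \frac{n^2(r-1)}{2r} \right\rfloor , \] and equality holds if and only if $G \cong T(n,r)$ and $G \in \mathcal{S}$, i.e. writing $s$ for the remainder of $n$ modulo $r$ ($0\le s<r$), either $s \le 2$ or $r < \frac{s^2}{s-2}$.
   Context: For positive integers $n$ and $r$, the Turán graph $T(n,r)$ is the complete multipartite graph on $n$ vertices with $r$ classes, each of size $\lceil n/r\rceil$ or $\lfloor n/r\rfloor$. $\mathcal{S}$ denotes the class of Turán graphs $T(n,r)$ such that, with $n \equiv s \pmod r$ and $0\le s<r$, either $s\le 2$ or $r < \frac{s^2}{s-2}$. *)

theory Defs
  imports Complex_Main "HOL-Library.Ramsey"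
begin

type_synonym 'a ugraph = "'a set \<times> 'a set set"

definition simple_graph :: "'a ugraph \<Rightarrow> bool" where
  "simple_graph G \<longleftrightarrow> finite (fst G) \<and> snd G \<subseteq> [fst G]\<^bsup>2\<^esup>"

definition ugraph_iso :: "'a ugraph \<Rightarrow> 'b ugraph \<Rightarrow> bool"  (infix \<open>\<cong>\<^sub>g\<close> 50) where
  "G \<cong>\<^sub>g H \<longleftrightarrow> (\<exists>f. bij_betw f (fst G) (fst H) \<and>
     (\<forall>u\<in>fst G. \<forall>v\<in>fst G. {u, v} \<in> snd G \<longleftrightarrow> {f u, f v} \<in> snd H))"

definition complete_graph :: "nat \<Rightarrow> nat ugraph" where
  "complete_graph k = ({..<k}, [{..<k}]\<^bsup>2\<^esup>)"

definition subgraph :: "'a ugraph \<Rightarrow> 'a ugraph \<Rightarrow> bool" where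
  "subgraph H G \<longleftrightarrow> simple_graph H \<and> fst H \<subseteq> fst G \<and> snd H \<subseteq> snd G"

definition clique_free :: "nat \<Rightarrow> 'a ugraph \<Rightarrow> bool" where
  "clique_free k G \<longleftrightarrow> \<not> (\<exists>H. subgraph H G \<and> H \<cong>\<^sub>g complete_graph k)"

text \<open>The complete multipartite graph on \<open>V\<close> whose classes are the fibres of \<open>c\<close>.\<close>

definition complete_multipartite :: "'a set \<Rightarrow> ('a \<Rightarrow> 'c) \<Rightarrow> 'a ugraph" where
  "complete_multipartite V c = (V, {{u, v} | u v. u \<in> V \<and> v \<in> V \<and> c u \<noteq> c v})"

text \<open>
  The \<open>r\<close> classes are the residue classes modulo \<open>r\<close> in \<open>{0..<n}\<close>; for \<open>n < r\<close> some of
  them are empty and the graph is complete. The lemmas below show that the class sizes are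
  \<open>\<lfloor>n/r\<rfloor>\<close> or \<open>\<lceil>n/r\<rceil>\<close>, and that every complete multipartite graph with \<open>r\<close> classes of such
  sizes is isomorphic to it.
\<close>

definition turan_graph :: "nat \<Rightarrow> nat \<Rightarrow> nat ugraph" where
  "turan_graph n r = complete_multipartite {..<n} (\<lambda>i. i mod r)"

lemma clique_free_iff_clique:
  assumes "simple_graph G"
  shows "clique_free k G \<longleftrightarrow> \<not> (\<exists>K\<subseteq>fst G. card K = k \<and> clique K (snd G))"
proof
  assume free: "clique_free k G"
  show "\<not> (\<exists>K\<subseteq>fst G. card K = k \<and> clique K (snd G))"
  proof
    assume "\<exists>K\<subseteq>fst G. card K = k \<and> clique K (snd G)"
    then obtain K where K: "K \<subseteq> fst G" "card K = k" "clique K (snd G)" by blast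
    have fin: "finite K"
      using K(1) assms finite_subset by (auto simp: simple_graph_def)
    obtain f where f: "bij_betw f K {..<k}"
      using fin K(2) by (metis bij_betw_iff_card finite_lessThan card_lessThan)
    have "[K]\<^bsup>2\<^esup> \<subseteq> snd G"
      using K(3) by (auto simp: clique_def elim!: nsets2_E)
    then have "subgraph (K, [K]\<^bsup>2\<^esup>) G"
      using K fin by (auto simp: subgraph_def simple_graph_def)
    moreover have "(K, [K]\<^bsup>2\<^esup>) \<cong>\<^sub>g complete_graph k"
      unfolding ugraph_iso_def complete_graph_def
      using f by (intro exI[of _ f]) (auto simp: bij_betw_def inj_on_def)
    ultimately show False using free by (auto simp: clique_free_def)
  qed
next
  assume none: "\<not> (\<exists>K\<subseteq>fst G. card K = k \<and> clique K (snd G))"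
  show "clique_free k G"
    unfolding clique_free_def
  proof
    assume "\<exists>H. subgraph H G \<and> H \<cong>\<^sub>g complete_graph k"
    then obtain H f where H: "subgraph H G"
      and f: "bij_betw f (fst H) {..<k}"
      and e: "\<forall>u\<in>fst H. \<forall>v\<in>fst H. {u, v} \<in> snd H \<longleftrightarrow> {f u, f v} \<in> [{..<k}]\<^bsup>2\<^esup>"
      by (auto simp: ugraph_iso_def complete_graph_def)
    have "card (fst H) = k" using bij_betw_same_card[OF f] by simp
    moreover have "clique (fst H) (snd G)"
    proof -
      have "{u, v} \<in> snd H" if "u \<in> fst H" "v \<in> fst H" "u \<noteq> v" for u v
      proof -
        have "f u \<noteq> f v" "f u < k" "f v < k"
          using f that by (auto simp: bij_betw_def inj_on_def)
        then show ?thesis using e that by simp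
      qed
      then show ?thesis using H by (auto simp: clique_def subgraph_def)
    qed
    ultimately show False using none H by (auto simp: subgraph_def)
  qed
qed

lemma turan_class_card:
  assumes "r > 0" "j < r"
  shows "card {i \<in> {..<n}. i mod r = j} = n div r + (if j < n mod r then 1 else 0)"
proof (induction n)
  case 0
  show ?case by simp
next
  case (Suc n)
  have "{i \<in> {..<Suc n}. i mod r = j} =
      (if n mod r = j then insert n {i \<in> {..<n}. i mod r = j} else {i \<in> {..<n}. i mod r = j})"
    by (auto simp: less_Suc_eq)
  then have "card {i \<in> {..<Suc n}. i mod r = j} =
      (if n mod r = j then 1 else 0) + card {i \<in> {..<n}. i mod r = j}"
    by simp
  then show ?case
    using Suc assms by (auto simp: mod_Suc div_Suc)
qed

lemma turan_class_sizes:
  assumes "r > 0" "j < r"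
  shows "int (card {i \<in> {..<n}. i mod r = j}) \<in> {\<lfloor>real n / real r\<rfloor>, \<lceil>real n / real r\<rceil>}"
proof -
  have fl: "\<lfloor>real n / real r\<rfloor> = int (n div r)"
    by (simp add: floor_divide_of_nat_eq)
  show ?thesis
  proof (cases "j < n mod r")
    case False
    then show ?thesis using fl turan_class_card[OF assms, of n] by simp
  next
    case True
    then have nd: "n mod r \<noteq> 0" by simp
    have eq: "real n = real (n div r) * real r + real (n mod r)"
      by (metis div_mult_mod_eq of_nat_add of_nat_mult)
    have "real n / real r = real (n div r) + real (n mod r) / real r"
      using assms by (subst eq) (simp add: field_simps)
    moreover have "0 < real (n mod r) / real r" "real (n mod r) / real r < 1"
      using nd assms by auto
    ultimately have "\<lceil>real n / real r\<rceil> = int (n div r) + 1"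
      by (intro ceiling_unique) auto
    then show ?thesis using True turan_class_card[OF assms, of n] by simp
  qed
qed

lemma balanced_multipartite_iso_turan:
  fixes c :: "'a \<Rightarrow> nat"
  assumes r: "r > 0" and fin: "finite V" and n: "card V = n"
    and cr: "\<And>v. v \<in> V \<Longrightarrow> c v < r"
    and bal: "\<And>j. j < r \<Longrightarrow> int (card {v \<in> V. c v = j}) \<in> {\<lfloor>real n / real r\<rfloor>, \<lceil>real n / real r\<rceil>}"
  shows "complete_multipartite V c \<cong>\<^sub>g turan_graph n r"
proof -
  define A where "A j = {v \<in> V. c v = j}" for j
  define B where "B j = {i \<in> {..<n}. i mod r = j}" for j
  define q where "q = n div r"
  define X where "X = {j. j < r \<and> card (A j) = Suc q}"
  define Y where "Y = {..<n mod r}"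
  have finX: "finite X" unfolding X_def by simp
  have mr: "n mod r < r" using r by simp
  have Aq: "card (A j) = q + (if j \<in> X then 1 else 0)" if "j < r" for j
  proof -
    have "\<lceil>real n / real r\<rceil> \<le> \<lfloor>real n / real r\<rfloor> + 1" by linarith
    moreover have "\<lfloor>real n / real r\<rfloor> \<le> \<lceil>real n / real r\<rceil>" by linarith
    moreover have "\<lfloor>real n / real r\<rfloor> = int q"
      by (simp add: q_def floor_divide_of_nat_eq)
    ultimately have "card (A j) = q \<or> card (A j) = Suc q"
      using bal[OF that] unfolding A_def by auto
    then show ?thesis using that by (auto simp: X_def)
  qed
  have "n = card (\<Union>j\<in>{..<r}. A j)"
    unfolding n[symmetric] by (rule arg_cong[of _ _ card]) (auto simp: A_def cr)
  also have "\<dots> = (\<Sum>j<r. card (A j))"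
    by (rule card_UN_disjoint) (auto simp: A_def fin)
  also have "\<dots> = (\<Sum>j<r. q + (if j \<in> X then 1 else 0))"
    by (rule sum.cong) (auto simp: Aq)
  also have "\<dots> = r * q + card ({..<r} \<inter> X)"
    by (simp add: sum.distrib sum.If_cases)
  also have "{..<r} \<inter> X = X" by (auto simp: X_def)
  finally have "card X = n mod r"
    unfolding q_def by (metis add_left_cancel mult_div_mod_eq)
  then have "card X = card Y" by (simp add: Y_def)
  then obtain g where g: "bij_betw g X Y"
    using finX by (metis bij_betw_iff_card finite_lessThan Y_def)
  have "card ({..<r} - X) = card ({..<r} - Y)"
    using \<open>card X = card Y\<close> finX mr
    by (subst (1 2) card_Diff_subset) (auto simp: X_def Y_def)
  then obtain h where h: "bij_betw h ({..<r} - X) ({..<r} - Y)"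
    by (metis bij_betw_iff_card finite_Diff finite_lessThan)
  define p where "p j = (if j \<in> X then g j else h j)" for j
  have p1: "bij_betw p X Y" using g by (subst bij_betw_cong[of _ _ g]) (auto simp: p_def)
  have p2: "bij_betw p ({..<r} - X) ({..<r} - Y)"
    using h by (subst bij_betw_cong[of _ _ h]) (auto simp: p_def)
  have "bij_betw p (X \<union> ({..<r} - X)) (Y \<union> ({..<r} - Y))"
    by (rule bij_betw_combine[OF p1 p2]) auto
  moreover have "X \<union> ({..<r} - X) = {..<r}" "Y \<union> ({..<r} - Y) = {..<r}"
    using mr by (auto simp: X_def Y_def)
  ultimately have p: "bij_betw p {..<r} {..<r}" by simp
  have pr: "p j < r" if "j < r" for j using p that by (auto simp: bij_betw_def)
  have pY: "p j \<in> Y \<longleftrightarrow> j \<in> X" if "j < r" for j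
    using p1 p2 that by (auto simp: bij_betw_def)
  have "\<exists>f. bij_betw f (A j) (B (p j))" if "j < r" for j
  proof -
    have "card (A j) = card (B (p j))"
      using turan_class_card[OF r pr[OF that], of n] Aq[OF that] pY[OF that]
      by (auto simp: B_def Y_def q_def)
    moreover have "finite (A j)" "finite (B (p j))"
      using fin by (auto simp: A_def B_def)
    ultimately show ?thesis
      by (simp add: bij_betw_iff_card)
  qed
  then obtain f where f: "\<And>j. j < r \<Longrightarrow> bij_betw (f j) (A j) (B (p j))" by metis
  define F where "F v = f (c v) v" for v
  have FB: "F v \<in> B (p (c v))" if "v \<in> V" for v
    using f[OF cr[OF that]] that by (auto simp: F_def A_def bij_betw_def)
  have Fmod: "F v mod r = p (c v)" and Fn: "F v < n" if "v \<in> V" for v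
    using FB[OF that] by (auto simp: B_def)
  have ceq: "F u mod r = F v mod r \<longleftrightarrow> c u = c v" if "u \<in> V" "v \<in> V" for u v
    using p Fmod that cr by (auto simp: bij_betw_def inj_on_def)
  have inj: "inj_on F V"
  proof (rule inj_onI)
    fix u v assume uv: "u \<in> V" "v \<in> V" "F u = F v"
    then have "c u = c v" using ceq by metis
    then show "u = v"
      using uv f[OF cr[OF uv(1)]] by (auto simp: F_def A_def bij_betw_def inj_on_def)
  qed
  have "F ` V = {..<n}"
    by (rule card_subset_eq) (use Fn inj n in \<open>auto simp: card_image\<close>)
  then have bij: "bij_betw F V {..<n}" using inj by (simp add: bij_betw_def)
  show ?thesis
    unfolding ugraph_iso_def turan_graph_def complete_multipartite_def fst_conv snd_conv
  proof (intro exI[of _ F] conjI ballI bij)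
    fix u v assume "u \<in> V" "v \<in> V"
    then show "{u, v} \<in> {{u, v} |u v. u \<in> V \<and> v \<in> V \<and> c u \<noteq> c v} \<longleftrightarrow>
        {F u, F v} \<in> {{u, v} |u v. u \<in> {..<n} \<and> v \<in> {..<n} \<and> u mod r \<noteq> v mod r}"
      using ceq[of u v] Fn[of u] Fn[of v] by (auto simp: doubleton_eq_iff)
  qed
qed

end

theory Submission
  imports Defs
begin

text \<open>
  Erd\H{o}s' degree majorisation: in a \<open>K\<^bsub>r+1\<^esub>\<close>-free graph the neighbourhood of a vertex of
  maximum degree is \<open>K\<^bsub>r\<^esub>\<close>-free, so by induction on \<open>r\<close> it is dominated degree by degree by
  a complete \<open>(r-1)\<close>-partite graph; the non-neighbours form the remaining class, and if all
  degrees agree then the two graphs coincide. For class sizes \<open>a\<^sub>j\<close> and \<open>n = r q + s\<close>, the defect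
  from the Tur\'an graph is \<open>\<Sum>\<^sub>j (a\<^sub>j - q) (a\<^sub>j - q - 1) / 2\<close>, a sum of nonnegative terms vanishing
  exactly on balanced partitions. Finally the Tur\'an graph misses \<open>n\<^sup>2 (r - 1) / (2 r)\<close> by
  \<open>s (r - s) / (2 r)\<close>, which is less than \<open>1\<close> exactly for the graphs in \<open>\<S>\<close>.
\<close>

section \<open>Neighbourhoods and degree sums\<close>

definition neighbours :: "'a set \<Rightarrow> 'a set set \<Rightarrow> 'a \<Rightarrow> 'a set" where
  "neighbours V E u = {v \<in> V. {u, v} \<in> E}"

text \<open>Double counting of the ordered pairs \<open>(u, v)\<close> with
  \<open>{u, v} \<in> E\<close>: they are grouped once by \<open>u\<close> and once by edge, where
  \<open>P e\<close> consists of the two orientations of \<open>e\<close>.\<close>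

lemma handshake:
  assumes "simple_graph G"
  shows "(\<Sum>u\<in>fst G. card (neighbours (fst G) (snd G) u)) = 2 * card (snd G)"
proof -
  obtain V E where G: "G = (V, E)" by (cases G)
  have V: "finite V" and E: "E \<subseteq> [V]\<^bsup>2\<^esup>"
    using assms by (auto simp: G simple_graph_def)
  have finE: "finite E"
    using E V by (meson finite_imp_finite_nsets finite_subset)
  define P where "P e = {(u, v). {u, v} = e}" for e :: "'a set"
  have P: "finite (P e) \<and> card (P e) = 2" if e: "e \<in> E" for e
  proof -
    from e E obtain a b where ab: "e = {a, b}" "a \<noteq> b" by (auto elim!: nsets2_E)
    then have "P e = {(a, b), (b, a)}" by (auto simp: P_def doubleton_eq_iff)
    then show ?thesis using ab by simp
  qed
  have "(\<Sum>u\<in>V. card (neighbours V E u)) = card (SIGMA u:V. neighbours V E u)"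
    using V by (subst card_SigmaI) (auto simp: neighbours_def)
  also have "(SIGMA u:V. neighbours V E u) = (\<Union>e\<in>E. P e)"
    using E by (auto simp: neighbours_def P_def nsets_def)
  also have "card \<dots> = (\<Sum>e\<in>E. card (P e))"
    using finE P by (intro card_UN_disjoint) (auto simp: P_def)
  also have "\<dots> = 2 * card E" using P by simp
  finally show ?thesis by (simp add: G)
qed

section \<open>Degree majorisation\<close>

text \<open>The induction shrinks \<open>V\<close> to a neighbourhood while \<open>E\<close> stays
  fixed, so looplessness is assumed instead of \<open>E\<close> lying within \<open>V\<close>. The
  rigidity clause is carried along because uniqueness of the extremal graph rests on it.\<close>

lemma degree_majorisation:
  assumes "finite V" and "\<And>v. {v} \<notin> E"
    and "\<not> (\<exists>K\<subseteq>V. card K = Suc r \<and> clique K E)"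
  shows "\<exists>c :: 'a \<Rightarrow> nat. (\<forall>v\<in>V. c v < r) \<and>
    (\<forall>v\<in>V. card (neighbours V E v) \<le> card {w \<in> V. c w \<noteq> c v}) \<and>
    ((\<forall>v\<in>V. card (neighbours V E v) = card {w \<in> V. c w \<noteq> c v}) \<longrightarrow>
      (\<forall>u\<in>V. \<forall>v\<in>V. {u, v} \<in> E \<longleftrightarrow> c u \<noteq> c v))"
  using assms
proof (induction r arbitrary: V)
  case 0
  have "V = {}"
  proof (rule ccontr)
    assume "V \<noteq> {}"
    then obtain v where "v \<in> V" by auto
    then have "{v} \<subseteq> V \<and> card {v} = Suc 0 \<and> clique {v} E" by (auto simp: clique_def)
    then show False using "0.prems"(3) by blast
  qed
  then show ?case by simp
next
  case (Suc r)
  show ?case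
  proof (cases "V = {}")
    case True
    then show ?thesis by simp
  next
    case False
    define N where "N = neighbours V E"
    have fN: "finite (N u)" and NV: "N u \<subseteq> V" for u
      using Suc.prems(1) by (auto simp: N_def neighbours_def)
    have "Max ((\<lambda>u. card (N u)) ` V) \<in> (\<lambda>u. card (N u)) ` V"
      using False Suc.prems(1) by (intro Max_in) auto
    then obtain x where x: "x \<in> V" and "Max ((\<lambda>u. card (N u)) ` V) = card (N x)"
      by (elim imageE)
    then have max: "card (N u) \<le> card (N x)" if "u \<in> V" for u
      using that Suc.prems(1) by (metis Max_ge finite_imageI imageI)
    \<comment> \<open>A clique in \<open>W\<close> extends by \<open>x\<close>, so the induction
      hypothesis applies to \<open>W\<close>.\<close>
    define W where "W = N x"
    have W: "W \<subseteq> V" "finite W" and xW: "x \<notin> W"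
      using NV fN Suc.prems(2) by (auto simp: W_def N_def neighbours_def)
    have "\<not> (\<exists>K\<subseteq>W. card K = Suc r \<and> clique K E)"
    proof
      assume "\<exists>K\<subseteq>W. card K = Suc r \<and> clique K E"
      then obtain K where K: "K \<subseteq> W" "card K = Suc r" "clique K E" by blast
      have "card (insert x K) = Suc (Suc r)"
        using K xW W(2) by (subst card_insert_disjoint) (auto intro: finite_subset)
      moreover have "clique (insert x K) E"
        using K by (auto simp: clique_def W_def N_def neighbours_def insert_commute)
      moreover have "insert x K \<subseteq> V" using K W x by auto
      ultimately show False using Suc.prems(3) by blast
    qed
    from Suc.IH[OF W(2) Suc.prems(2) this] obtain c where
      c_less: "\<And>v. v \<in> W \<Longrightarrow> c v < r" and
      c_deg: "\<And>v. v \<in> W \<Longrightarrow> card (neighbours W E v) \<le> card {w \<in> W. c w \<noteq> c v}" and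
      c_eq: "(\<forall>v\<in>W. card (neighbours W E v) = card {w \<in> W. c w \<noteq> c v}) \<Longrightarrow>
        \<forall>u\<in>W. \<forall>v\<in>W. {u, v} \<in> E \<longleftrightarrow> c u \<noteq> c v"
      by blast
    \<comment> \<open>The non-neighbours of \<open>x\<close>, including \<open>x\<close> itself,
      form a new class; its colour \<open>r\<close> is fresh because \<open>c\<close> stays below
      \<open>r\<close> on \<open>W\<close>.\<close>
    define d where "d v = (if v \<in> W then c v else r)" for v
    have d_in: "card {w \<in> V. d w \<noteq> d v} = card {w \<in> W. c w \<noteq> c v} + card (V - W)"
      if "v \<in> W" for v
    proof -
      have "{w \<in> V. d w \<noteq> d v} = {w \<in> W. c w \<noteq> c v} \<union> (V - W)"
        using that W c_less[OF that] by (auto simp: d_def)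
      then show ?thesis
        using W Suc.prems(1) by (simp add: card_Un_disjoint disjoint_iff)
    qed
    have d_out: "{w \<in> V. d w \<noteq> d v} = W" if "v \<notin> W" for v
      using that W c_less by (auto simp: d_def)
    have N_in: "card (N v) = card (neighbours W E v) + card (N v - W)" for v
    proof -
      have "N v = neighbours W E v \<union> (N v - W)"
        using W by (auto simp: N_def neighbours_def)
      moreover have "card (neighbours W E v \<union> (N v - W)) =
          card (neighbours W E v) + card (N v - W)"
        using W fN by (intro card_Un_disjoint) (auto simp: neighbours_def)
      ultimately show ?thesis by simp
    qed
    have out_le: "card (N v - W) \<le> card (V - W)" for v
      using NV Suc.prems(1) by (intro card_mono) auto
    have deg: "card (N v) \<le> card {w \<in> V. d w \<noteq> d v}" if "v \<in> V" for v
    proof (cases "v \<in> W")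
      case True
      then show ?thesis using d_in N_in[of v] out_le[of v] c_deg[of v] by simp
    next
      case False
      \<comment> \<open>Outside \<open>W\<close> the multipartite degree is
        \<open>card W = card (N x)\<close>, so maximality of \<open>x\<close> suffices.\<close>
      then show ?thesis using d_out max[OF that] by (simp add: W_def)
    qed
    have eq: "{u, v} \<in> E \<longleftrightarrow> d u \<noteq> d v"
      if all: "\<forall>v\<in>V. card (N v) = card {w \<in> V. d w \<noteq> d v}" and uv: "u \<in> V" "v \<in> V" for u v
    proof -
      \<comment> \<open>The degree bound on \<open>W\<close> is the sum of an inner and an outer
        inequality; equality of the sums forces equality in both.\<close>
      have sums: "card (neighbours W E v) = card {w \<in> W. c w \<noteq> c v} \<and>
          card (N v - W) = card (V - W)" if "v \<in> W" for v
        using all that W d_in[OF that] N_in[of v] out_le[of v] c_deg[OF that] by fastforce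
      have inside: "{u, v} \<in> E \<longleftrightarrow> c u \<noteq> c v" if "u \<in> W" "v \<in> W" for u v
        using c_eq sums that by blast
      have cross: "{u, v} \<in> E" if "u \<in> W" "v \<in> V - W" for u v
      proof -
        have "N u - W = V - W"
          using sums[OF that(1)] NV Suc.prems(1) by (intro card_subset_eq) auto
        then show ?thesis using that by (auto simp: N_def neighbours_def)
      qed
      have outside: "{u, v} \<notin> E" if "u \<in> V - W" "v \<in> V - W" for u v
      proof -
        \<comment> \<open>All cross edges are present, so \<open>W\<close> already exhausts the
          degree of \<open>u\<close> and leaves no neighbour outside \<open>W\<close>.\<close>
        have "W \<subseteq> N u"
          using cross that(1) W by (auto simp: N_def neighbours_def insert_commute)
        moreover have "card W = card (N u)" using all that(1) d_out by auto
        ultimately have "W = N u" using fN card_subset_eq by blast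
        then show ?thesis using that by (auto simp: N_def neighbours_def)
      qed
      show ?thesis
        using inside[of u v] cross[of u v] cross[of v u] outside[of u v] uv
          c_less[of u] c_less[of v]
        by (auto simp: d_def insert_commute)
    qed
    show ?thesis
    proof (intro exI[of _ d] conjI ballI impI)
      show "d v < Suc r" for v
        using c_less[of v] by (auto simp: d_def)
    qed (use deg eq in \<open>auto simp: N_def\<close>)
  qed
qed

section \<open>Edge counts of complete multipartite graphs\<close>

lemma simple_complete_multipartite:
  "finite V \<Longrightarrow> simple_graph (complete_multipartite V c)"
  by (auto simp: simple_graph_def complete_multipartite_def)

lemma neighbours_complete_multipartite:
  assumes "u \<in> V"
  shows "neighbours V (snd (complete_multipartite V c)) u = {w \<in> V. c w \<noteq> c u}"
  using assms by (auto simp: neighbours_def complete_multipartite_def doubleton_eq_iff)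

text \<open>A vertex in a class of size \<open>a\<close> has degree \<open>card V - a\<close>, and
  summing \<open>a\<close> over that class gives its square. Doubling and passing to
  \<open>int\<close> avoids division and truncated subtraction.\<close>

lemma card_edges_complete_multipartite:
  fixes c :: "'a \<Rightarrow> nat"
  assumes V: "finite V" and c: "\<And>v. v \<in> V \<Longrightarrow> c v < r"
  shows "2 * int (card (snd (complete_multipartite V c))) =
    (int (card V))\<^sup>2 - (\<Sum>j<r. (int (card {v \<in> V. c v = j}))\<^sup>2)"
proof -
  let ?a = "\<lambda>j. card {v \<in> V. c v = j}"
  have nb: "int (card {w \<in> V. c w \<noteq> c u}) = int (card V) - int (?a (c u))" for u
  proof -
    have "{w \<in> V. c w \<noteq> c u} = V - {w \<in> V. c w = c u}" by auto
    then show ?thesis using V by (simp add: card_Diff_subset of_nat_diff card_mono)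
  qed
  have "2 * int (card (snd (complete_multipartite V c))) =
      int (\<Sum>u\<in>V. card (neighbours V (snd (complete_multipartite V c)) u))"
    using handshake[OF simple_complete_multipartite[OF V, of c]]
    by (simp add: complete_multipartite_def)
  also have "\<dots> = (\<Sum>u\<in>V. int (card V) - int (?a (c u)))"
    by (simp add: neighbours_complete_multipartite nb)
  also have "\<dots> = (int (card V))\<^sup>2 - (\<Sum>u\<in>V. int (?a (c u)))"
    by (simp add: sum_subtractf power2_eq_square)
  also have "(\<Sum>u\<in>V. int (?a (c u))) = (\<Sum>j<r. \<Sum>u\<in>{v \<in> V. c v = j}. int (?a (c u)))"
    using V c by (intro sum.group[symmetric]) auto
  also have "\<dots> = (\<Sum>j<r. (int (?a j))\<^sup>2)"
    by (simp add: power2_eq_square)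
  finally show ?thesis .
qed

text \<open>Separates a part depending only on \<open>n\<close> and \<open>r\<close> from a penalty
  for unbalanced classes. The products are expanded using that the class sizes sum to
  \<open>n\<close>, and then \<open>n = r * q + s\<close> is substituted.\<close>

lemma edge_defect_complete_multipartite:
  fixes c :: "'a \<Rightarrow> nat" and V :: "'a set" and r :: nat
  defines "n \<equiv> card V"
  defines "q \<equiv> int (n div r)" and "s \<equiv> int (n mod r)"
  assumes V: "finite V" and c: "\<And>v. v \<in> V \<Longrightarrow> c v < r"
  shows "2 * int r * int (card (snd (complete_multipartite V c))) =
    (int n)\<^sup>2 * (int r - 1) - s * (int r - s) -
    int r * (\<Sum>j<r. (int (card {v \<in> V. c v = j}) - q) * (int (card {v \<in> V. c v = j}) - q - 1))"
proof -
  let ?a = "\<lambda>j. int (card {v \<in> V. c v = j})"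
  have n: "int n = int r * q + s"
    unfolding q_def s_def by (metis mult_div_mod_eq of_nat_add of_nat_mult)
  have "int n = (\<Sum>v\<in>V. 1)" by (simp add: n_def)
  also have "\<dots> = (\<Sum>j<r. \<Sum>v\<in>{v \<in> V. c v = j}. 1)"
    using V c by (intro sum.group[symmetric]) auto
  finally have total: "(\<Sum>j<r. ?a j) = int n" by simp
  have "(\<Sum>j<r. (?a j - q) * (?a j - q - 1)) =
      (\<Sum>j<r. (?a j)\<^sup>2 - (2 * q + 1) * ?a j + q * (q + 1))"
    by (intro sum.cong) (auto simp: algebra_simps power2_eq_square)
  also have "\<dots> = (\<Sum>j<r. (?a j)\<^sup>2) - (2 * q + 1) * int n + int r * (q * (q + 1))"
    by (simp add: sum.distrib sum_subtractf total flip: sum_distrib_left)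
  also have "(\<Sum>j<r. (?a j)\<^sup>2) =
      (int n)\<^sup>2 - 2 * int (card (snd (complete_multipartite V c)))"
    using card_edges_complete_multipartite[OF V c] by (simp add: n_def)
  finally have defect: "(\<Sum>j<r. (?a j - q) * (?a j - q - 1)) =
      (int n)\<^sup>2 - 2 * int (card (snd (complete_multipartite V c))) -
      (2 * q + 1) * int n + int r * (q * (q + 1))" .
  show ?thesis
    unfolding defect n by algebra
qed

text \<open>Every class has size \<open>q\<close> or \<open>q + 1\<close> with
  \<open>q = n div r\<close>, so each penalty term has a zero factor.\<close>

lemma card_edges_turan:
  assumes "r > 0"
  shows "2 * int r * int (card (snd (turan_graph n r))) =
    (int n)\<^sup>2 * (int r - 1) - int (n mod r) * (int r - int (n mod r))"
proof -
  have "(int (card {v \<in> {..<n}. v mod r = j}) - int (n div r)) *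
      (int (card {v \<in> {..<n}. v mod r = j}) - int (n div r) - 1) = 0" if "j < r" for j
    using turan_class_card[OF assms that, of n] by auto
  then have "(\<Sum>j<r. (int (card {v \<in> {..<n}. v mod r = j}) - int (n div r)) *
      (int (card {v \<in> {..<n}. v mod r = j}) - int (n div r) - 1)) = 0"
    by (intro sum.neutral) blast
  then show ?thesis
    using edge_defect_complete_multipartite[of "{..<n}" "\<lambda>i. i mod r" r] assms
    unfolding turan_graph_def by simp
qed

text \<open>No integer lies strictly between \<open>q\<close> and \<open>q + 1\<close>, so the
  factors never have opposite signs.\<close>

lemma int_consecutive_prod_nonneg: "0 \<le> (k - q) * (k - q - 1)" for k q :: int
  by (cases "k \<le> q") (auto intro: mult_nonneg_nonneg mult_nonpos_nonpos)

text \<open>The two edge counts differ by half the sum of the nonnegative penalties. Equality kills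
  every penalty, which leaves only the class sizes \<open>q\<close> and
  \<open>q + 1\<close>.\<close>

lemma complete_multipartite_edges_le_turan:
  fixes c :: "'a \<Rightarrow> nat"
  assumes r: "r > 0" and V: "finite V" and c: "\<And>v. v \<in> V \<Longrightarrow> c v < r"
  shows "card (snd (complete_multipartite V c)) \<le> card (snd (turan_graph (card V) r))"
    and "card (snd (complete_multipartite V c)) = card (snd (turan_graph (card V) r)) \<Longrightarrow>
      complete_multipartite V c \<cong>\<^sub>g turan_graph (card V) r"
proof -
  let ?n = "card V"
  let ?H = "int (card (snd (complete_multipartite V c)))"
  let ?T = "int (card (snd (turan_graph ?n r)))"
  define q where "q = int (?n div r)"
  define D where "D j = (int (card {v \<in> V. c v = j}) - q) *
    (int (card {v \<in> V. c v = j}) - q - 1)" for j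
  have D: "D j \<ge> 0" for j
    unfolding D_def by (rule int_consecutive_prod_nonneg)
  have "2 * int r * ?H = 2 * int r * ?T - int r * (\<Sum>j<r. D j)"
    unfolding D_def q_def card_edges_turan[OF r]
    by (rule edge_defect_complete_multipartite[OF V c])
  then have "int r * (2 * ?H) = int r * (2 * ?T - (\<Sum>j<r. D j))"
    by (simp add: algebra_simps)
  then have HT: "2 * ?H = 2 * ?T - (\<Sum>j<r. D j)"
    using r by simp
  then show "card (snd (complete_multipartite V c)) \<le> card (snd (turan_graph ?n r))"
    using sum_nonneg[of "{..<r}" D, OF D] by linarith
  show "complete_multipartite V c \<cong>\<^sub>g turan_graph ?n r"
    if "card (snd (complete_multipartite V c)) = card (snd (turan_graph ?n r))"
  proof (rule balanced_multipartite_iso_turan[OF r V refl c])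
    fix j assume "j < r"
    have "(\<Sum>j<r. D j) = 0" using HT that by simp
    then have D0: "D i = 0" if "i < r" for i
      using that D by (simp add: sum_nonneg_eq_0_iff)
    let ?a = "int (card {v \<in> V. c v = j})"
    have a: "?a = q \<or> ?a = q + 1"
      using D0[OF \<open>j < r\<close>] by (auto simp: D_def)
    have fl: "\<lfloor>real ?n / real r\<rfloor> = q"
      by (simp add: q_def floor_divide_of_nat_eq)
    \<comment> \<open>The ceiling is \<open>q + 1\<close> only if \<open>r\<close> does not divide
      the vertex count. Otherwise classes of size at least \<open>q\<close>, one of them larger,
      would sum to more than \<open>r * q\<close>.\<close>
    have "\<lceil>real ?n / real r\<rceil> = q + 1" if "?a = q + 1"
    proof -
      have "?n mod r \<noteq> 0"
      proof
        assume "?n mod r = 0"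
        then have n_eq: "int ?n = int r * q"
          unfolding q_def by (metis add.right_neutral mult_div_mod_eq of_nat_mult)
        have "int ?n = (\<Sum>v\<in>V. 1)" by simp
        also have "\<dots> = (\<Sum>j<r. \<Sum>v\<in>{v \<in> V. c v = j}. 1)"
          using V c by (intro sum.group[symmetric]) auto
        also have "\<dots> = (\<Sum>j<r. int (card {v \<in> V. c v = j}))" by simp
        also have "\<dots> > (\<Sum>j<r. q)"
        proof (rule sum_strict_mono_ex1)
          show "\<forall>i\<in>{..<r}. q \<le> int (card {v \<in> V. c v = i})"
            using D0 by (fastforce simp: D_def)
          show "\<exists>i\<in>{..<r}. q < int (card {v \<in> V. c v = i})"
            using \<open>j < r\<close> that by (intro bexI[of _ j]) auto
        qed simp
        finally show False using n_eq by simp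
      qed
      then have "\<not> r dvd ?n" by auto
      have "real ?n / real r \<noteq> of_int q"
      proof
        assume "real ?n / real r = of_int q"
        then have "real ?n = real (r * (?n div r))"
          using r by (simp add: q_def field_simps)
        then have "?n = r * (?n div r)" by (simp only: of_nat_eq_iff)
        then show False using \<open>\<not> r dvd ?n\<close> by (metis dvd_triv_left)
      qed
      then show ?thesis using fl by linarith
    qed
    then show "?a \<in> {\<lfloor>real ?n / real r\<rfloor>, \<lceil>real ?n / real r\<rceil>}"
      using a fl by auto
  qed
qed

section \<open>Clique-free graphs against the Turan graph\<close>

text \<open>Summed over all vertices, degree majorisation compares \<open>G\<close> with a complete
  multipartite graph \<open>H\<close> on the same vertices, and the penalty compares
  \<open>H\<close> with the Turan graph. Equality at the ends forces it at both stages.\<close>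

lemma turan_bound:
  fixes G :: "'a ugraph"
  assumes r: "r > 0" and G: "simple_graph G" "clique_free (r + 1) G"
  shows "card (snd G) \<le> card (snd (turan_graph (card (fst G)) r))"
    and "card (snd G) = card (snd (turan_graph (card (fst G)) r)) \<Longrightarrow>
      G \<cong>\<^sub>g turan_graph (card (fst G)) r"
proof -
  obtain V E where VE: "G = (V, E)" by (cases G)
  have V: "finite V" and E: "E \<subseteq> [V]\<^bsup>2\<^esup>"
    using G(1) by (auto simp: VE simple_graph_def)
  have "\<not> (\<exists>K\<subseteq>V. card K = Suc r \<and> clique K E)"
    using clique_free_iff_clique[OF G(1), of "r + 1"] G(2) by (simp add: VE)
  moreover have "{v} \<notin> E" for v using E by (auto simp: nsets_def)
  ultimately obtain c :: "'a \<Rightarrow> nat" where c: "\<And>v. v \<in> V \<Longrightarrow> c v < r"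
    and deg: "\<And>v. v \<in> V \<Longrightarrow> card (neighbours V E v) \<le> card {w \<in> V. c w \<noteq> c v}"
    and eq: "(\<forall>v\<in>V. card (neighbours V E v) = card {w \<in> V. c w \<noteq> c v}) \<Longrightarrow>
      \<forall>u\<in>V. \<forall>v\<in>V. {u, v} \<in> E \<longleftrightarrow> c u \<noteq> c v"
    using degree_majorisation[OF V, of E r] by blast
  define H where "H = complete_multipartite V c"
  have sumG: "2 * card E = (\<Sum>v\<in>V. card (neighbours V E v))"
    using handshake[OF G(1)] by (simp add: VE)
  have "fst H = V" by (simp add: H_def complete_multipartite_def)
  then have sumH: "2 * card (snd H) = (\<Sum>v\<in>V. card {w \<in> V. c w \<noteq> c v})"
    using handshake[OF simple_complete_multipartite[OF V, of c], folded H_def]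
    by (simp add: H_def neighbours_complete_multipartite)
  have le: "card E \<le> card (snd H)"
    using sum_mono[of V "\<lambda>v. card (neighbours V E v)" "\<lambda>v. card {w \<in> V. c w \<noteq> c v}"]
      deg sumG sumH by simp
  note leT = complete_multipartite_edges_le_turan[of r V c, OF r V c, folded H_def]
  show "card (snd G) \<le> card (snd (turan_graph (card (fst G)) r))"
    using le leT(1) by (simp add: VE)
  assume "card (snd G) = card (snd (turan_graph (card (fst G)) r))"
  then have EH: "card E = card (snd H)" and HT: "H \<cong>\<^sub>g turan_graph (card V) r"
    using le leT by (simp_all add: VE)
  \<comment> \<open>Pointwise bounds with equal sums are equalities; this triggers rigidity, so
    \<open>G\<close> is \<open>H\<close> itself and not merely isomorphic to it.\<close>
  have "\<forall>v\<in>V. card (neighbours V E v) = card {w \<in> V. c w \<noteq> c v}"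
    using sum_mono_inv[of "\<lambda>v. card (neighbours V E v)" V "\<lambda>v. card {w \<in> V. c w \<noteq> c v}"]
      EH sumG sumH deg V by simp
  then have adj: "{u, v} \<in> E \<longleftrightarrow> c u \<noteq> c v" if "u \<in> V" "v \<in> V" for u v
    using eq that by blast
  have "E = snd H"
  proof
    show "E \<subseteq> snd H"
    proof
      fix e assume e: "e \<in> E"
      then obtain u v where "e = {u, v}" "u \<in> V" "v \<in> V"
        using E by (auto elim!: nsets2_E)
      then show "e \<in> snd H"
        using adj e by (auto simp: H_def complete_multipartite_def)
    qed
    show "snd H \<subseteq> E"
      using adj by (auto simp: H_def complete_multipartite_def)
  qed
  then have "G = H" by (simp add: VE H_def complete_multipartite_def)
  then show "G \<cong>\<^sub>g turan_graph (card (fst G)) r"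
    using HT \<open>fst H = V\<close> by simp
qed

section \<open>Isomorphism invariance of the edge count\<close>

text \<open>Isomorphism is phrased through pairs of vertices, so degrees transfer directly; the
  degree sum then replaces a bijection between the edge sets.\<close>

lemma ugraph_iso_card_edges:
  assumes G: "simple_graph G" and H: "simple_graph H" and "G \<cong>\<^sub>g H"
  shows "card (snd G) = card (snd H)"
proof -
  obtain f where f: "bij_betw f (fst G) (fst H)"
    and adj: "\<And>u v. u \<in> fst G \<Longrightarrow> v \<in> fst G \<Longrightarrow> {u, v} \<in> snd G \<longleftrightarrow> {f u, f v} \<in> snd H"
    using assms(3) by (auto simp: ugraph_iso_def)
  have nb: "card (neighbours (fst G) (snd G) u) = card (neighbours (fst H) (snd H) (f u))"
    if "u \<in> fst G" for u
  proof -
    have "f ` neighbours (fst G) (snd G) u = neighbours (fst H) (snd H) (f u)"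
      unfolding neighbours_def bij_betw_imp_surj_on[OF f, symmetric]
      using adj[OF that] by auto
    moreover have "inj_on f (neighbours (fst G) (snd G) u)"
      using f by (auto simp: neighbours_def bij_betw_def inj_on_def)
    ultimately show ?thesis by (metis card_image)
  qed
  have "2 * card (snd G) = (\<Sum>u\<in>fst G. card (neighbours (fst H) (snd H) (f u)))"
    using handshake[OF G] nb by simp
  also have "\<dots> = 2 * card (snd H)"
    unfolding handshake[OF H, symmetric] by (rule sum.reindex_bij_betw[OF f])
  finally show ?thesis by simp
qed

section \<open>Rounding and the condition on the remainder\<close>

text \<open>The inequality rearranges to \<open>r * (s - 2) < s^2\<close>. Dividing by
  \<open>s - 2\<close> is legitimate for \<open>s > 2\<close>; for smaller \<open>s\<close> the
  left-hand side always holds.\<close>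

lemma turan_deficit_less_one_iff:
  assumes "r > 0"
  shows "int s * (int r - int s) < 2 * int r \<longleftrightarrow>
    s \<le> 2 \<or> real r < (real s)\<^sup>2 / (real s - 2)"
proof (cases "s \<le> 2")
  case True
  then have "s = 0 \<or> s = 1 \<or> s = 2" by auto
  then show ?thesis using assms by auto
next
  case False
  then have "real r < (real s)\<^sup>2 / (real s - 2) \<longleftrightarrow>
      real_of_int (int s * (int r - int s)) < real_of_int (2 * int r)"
    by (simp add: pos_less_divide_eq algebra_simps power2_eq_square)
  then show ?thesis using False by (simp only: of_int_less_iff) simp
qed

theorem theorem2:
  fixes G :: "'a ugraph" and n r s :: nat
  assumes "r > 0" and "n > 0"
    and "simple_graph G" and "card (fst G) = n" and "clique_free (r + 1) G"
    and "s = n mod r"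
  shows "int (card (snd G)) \<le> \<lfloor>(real n)\<^sup>2 * (real r - 1) / (2 * real r)\<rfloor> \<and>
    (int (card (snd G)) = \<lfloor>(real n)\<^sup>2 * (real r - 1) / (2 * real r)\<rfloor> \<longleftrightarrow>
      G \<cong>\<^sub>g turan_graph n r \<and> (s \<le> 2 \<or> real r < (real s)\<^sup>2 / (real s - 2)))"
proof -
  define F where "F = \<lfloor>(real n)\<^sup>2 * (real r - 1) / (2 * real r)\<rfloor>"
  define t where "t = int (card (snd (turan_graph n r)))"
  have F: "F = ((int n)\<^sup>2 * (int r - 1)) div (2 * int r)"
  proof -
    have "(real n)\<^sup>2 * (real r - 1) / (2 * real r) =
        real_of_int ((int n)\<^sup>2 * (int r - 1)) / real_of_int (2 * int r)" by simp
    then show ?thesis unfolding F_def by (simp only: floor_divide_of_int_eq)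
  qed
  have turan: "(int n)\<^sup>2 * (int r - 1) = int s * (int r - int s) + 2 * int r * t"
    using card_edges_turan[OF assms(1), of n] assms(6) by (simp add: t_def)
  \<comment> \<open>The floor exceeds the Turan edge count by an integer quotient, which is zero
    exactly when its numerator is below \<open>2 * int r\<close>.\<close>
  have "F = t + (int s * (int r - int s)) div (2 * int r)"
    unfolding F turan using assms(1) by simp
  moreover have nonneg: "0 \<le> int s * (int r - int s)"
    using assms(1,6) by (simp add: less_imp_le)
  ultimately have tF: "t \<le> F"
    and tF_eq: "t = F \<longleftrightarrow> int s * (int r - int s) < 2 * int r"
    using assms(1) by (auto simp: pos_imp_zdiv_nonneg_iff zdiv_eq_0_iff)
  have le: "int (card (snd G)) \<le> t"
    and eq: "int (card (snd G)) = t \<Longrightarrow> G \<cong>\<^sub>g turan_graph n r"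
    using turan_bound[OF assms(1,3,5)] by (simp_all add: t_def assms(4))
  have "simple_graph (turan_graph n r)"
    by (simp add: turan_graph_def simple_complete_multipartite)
  then have "G \<cong>\<^sub>g turan_graph n r \<Longrightarrow> int (card (snd G)) = t"
    using ugraph_iso_card_edges[OF assms(3)] by (simp add: t_def)
  \<comment> \<open>In the chain \<open>card (snd G) \<le> t \<le> F\<close>, equality of the ends
    means equality in both links: the first characterises \<open>G\<close>, the second restricts
    \<open>s\<close>.\<close>
  then show ?thesis
    using le eq tF tF_eq turan_deficit_less_one_iff[OF assms(1), of s]
    unfolding F_def[symmetric] by auto
qed

end
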